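(* Let $R$ be a semiprime (associative, unital) ring, let $a,b\in Reg(R)$, and let $d\in R$ be defined by $a=d+b$. Then $I(a)\subseteq I(b)$ if and only if $bR\cap dR=0$ and $Rb\cap Rd=0$.
   Context: For an associative ring $R$ with unity and $a\in R$: an inner inverse of $a$ is an $x\in R$ with $axa=a$; $I(a)$ denotes the set of inner inverses of $a$; $a$ is (von Neumann) regular if $I(a)\neq\emptyset$, and $Reg(R)$ is the set of regular elements of $R$. The ring $R$ is semiprime if, for $c\in R$, $cRc=0$ implies $c=0$. *)

theory Defs imports Main begin

text \<open>Associative rings with unity are modelled by the sort \<open>{ring, monoid_mult}\<close> instead of
  the class \<open>ring_1\<close>, because the latter excludes the zero ring.\<close>

class semiprime_ring = ring + monoid_mult +
  assumes semiprime: "(\<forall>r. c * r * c = 0) \<Longrightarrow> c = 0"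

definition inner_inverses :: "'a::{ring, monoid_mult} \<Rightarrow> 'a set" where
  "inner_inverses a = {x. a * x * a = a}"

definition Reg :: "'a::{ring, monoid_mult} set" where
  "Reg = {a. inner_inverses a \<noteq> {}}"

definition right_principal :: "'a::{ring, monoid_mult} \<Rightarrow> 'a set" where
  "right_principal a = {a * r | r. True}"

definition left_principal :: "'a::{ring, monoid_mult} \<Rightarrow> 'a set" where
  "left_principal a = {r * a | r. True}"

end

theory Submission imports Defs begin

text \<open>
  Fix an inner inverse \<open>x\<close> of \<open>a\<close>. Both conditions are linked through the identities
  \<open>b * x * a = b\<close>, \<open>a * x * b = b\<close> and \<open>b * x * b = b\<close>.

  If every inner inverse of \<open>a\<close> is one of \<open>b\<close>, perturb \<open>x\<close>: each \<open>x + (1 - x * a) * u\<close> is again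
  an inner inverse of \<open>a\<close>, hence of \<open>b\<close>, so \<open>b * (1 - x * a) * u * b = 0\<close> for all \<open>u\<close>.
  Semiprimeness turns this into \<open>b * (1 - x * a) = 0\<close>, and \<open>a * x * b = b\<close> follows in the same way
  from \<open>x + u * (1 - a * x)\<close> (lemma \<open>inner_inverses_subset_absorb\<close>). Left
  multiplication by \<open>b * x\<close> is then the identity on \<open>bR\<close> and zero on \<open>dR\<close>, so these right ideals
  meet only in zero; the left ideals are treated symmetrically.

  Conversely, if the principal ideals of \<open>b\<close> and \<open>d\<close> intersect trivially, the equation
  \<open>a * x * a = a\<close> can be split along \<open>a = d + b\<close>, first on the left to get \<open>b * x * a = b\<close> and then
  on the right to get \<open>b * x * b = b\<close>.
\<close>

text \<open>
  The last two conclusions say that \<open>b\<close> lies in \<open>Ra\<close> and in \<open>aR\<close>. This is where semiprimeness enters: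
  varying the inner inverse of \<open>a\<close> only shows that \<open>b * (1 - x * a)\<close> annihilates \<open>R * b\<close>.
\<close>

lemma inner_inverses_subset_absorb:
  fixes a b x :: "'a::semiprime_ring"
  assumes sub: "inner_inverses a \<subseteq> inner_inverses b" and x: "a * x * a = a"
  shows "b * x * b = b" and "b * x * a = b" and "a * x * b = b"
proof -
  have inner: "b * y * b = b" if "a * y * a = a" for y
    using sub that by (auto simp: inner_inverses_def)
  show bxb: "b * x * b = b"
    by (rule inner[OF x])
  have axa: "a * (x * (a * z)) = a * z" for z
    using x by (metis mult.assoc)
  have axa': "a * (x * a) = a"
    using x by (simp add: mult.assoc)
  have bxb': "b * (x * b) = b"
    using bxb by (simp add: mult.assoc)
  have right: "(b - b * x * a) * u * b = 0" for u
  proof -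
    have "a * (x + (u - x * a * u)) * a = a"
      by (simp add: algebra_simps axa axa')
    from inner[OF this] show ?thesis
      by (simp add: algebra_simps bxb')
  qed
  have left: "b * u * (b - a * x * b) = 0" for u
  proof -
    have "a * (x + (u - u * a * x)) * a = a"
      by (simp add: algebra_simps axa axa')
    from inner[OF this] show ?thesis
      by (simp add: algebra_simps bxb')
  qed
  \<comment> \<open>The second factor \<open>b - b * x * a = b * (1 - x * a)\<close> begins with \<open>b\<close>, so the vanishing of
    \<open>(b - b * x * a) * u * b\<close> for all \<open>u\<close> yields the form \<open>c * r * c = 0\<close> that semiprimeness needs.\<close>
  have "(b - b * x * a) * r * (b - b * x * a) = 0" for r
  proof -
    have "(b - b * x * a) * r * (b - b * x * a)
        = (b - b * x * a) * r * b * (1 - x * a)"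
      by (simp add: algebra_simps)
    then show ?thesis by (simp only: right mult_zero_left)
  qed
  then show "b * x * a = b"
    using semiprime[of "b - b * x * a"] by simp
  have "(b - a * x * b) * r * (b - a * x * b) = 0" for r
  proof -
    have "(b - a * x * b) * r * (b - a * x * b)
        = (1 - a * x) * (b * r * (b - a * x * b))"
      by (simp add: algebra_simps)
    then show ?thesis by (simp only: left mult_zero_right)
  qed
  then show "a * x * b = b"
    using semiprime[of "b - a * x * b"] by simp
qed

text \<open>
  Left multiplication by \<open>b * x\<close> sends both \<open>a\<close> and \<open>b\<close> to \<open>b\<close>, hence kills \<open>d\<close>, while it fixes \<open>bR\<close>
  pointwise; so \<open>bR\<close> and \<open>dR\<close> can only meet in zero. For the left ideals, right multiplication by
  \<open>x * b\<close> does the same.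
\<close>

lemma right_principal_inter_trivialI:
  fixes a b d x :: "'a::{ring, monoid_mult}"
  assumes a: "a = d + b" and bxb: "b * x * b = b" and bxa: "b * x * a = b"
  shows "right_principal b \<inter> right_principal d = {0}"
proof -
  have "b * r = 0" if eq: "b * r = d * s" for r s
  proof -
    have "b * (r + s) = a * s"
      using eq a by (simp add: algebra_simps)
    then have "b * x * b * (r + s) = b * x * a * s"
      by (simp add: mult.assoc)
    then show ?thesis
      by (simp add: bxb bxa distrib_left)
  qed
  moreover have "0 = b * 0" "0 = d * 0" by simp_all
  ultimately show ?thesis
    unfolding right_principal_def by blast
qed

lemma left_principal_inter_trivialI:
  fixes a b d x :: "'a::{ring, monoid_mult}"
  assumes a: "a = d + b" and bxb: "b * x * b = b" and axb: "a * x * b = b"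
  shows "left_principal b \<inter> left_principal d = {0}"
proof -
  have "r * b = 0" if eq: "r * b = s * d" for r s
  proof -
    have "(r + s) * b = s * a"
      using eq a by (simp add: algebra_simps)
    then have "(r + s) * b * (x * b) = s * a * (x * b)"
      by simp
    then have "(r + s) * (b * x * b) = s * (a * x * b)"
      by (simp only: mult.assoc)
    then show ?thesis
      by (simp add: bxb axb distrib_right)
  qed
  moreover have "0 = 0 * b" "0 = 0 * d" by simp_all
  ultimately show ?thesis
    unfolding left_principal_def by blast
qed

text \<open>
  An element written both as a multiple of \<open>b\<close> and as a multiple of \<open>d\<close> on the same side vanishes.
  Comparing the \<open>b\<close>- and \<open>d\<close>-components of \<open>a * x * a = a\<close> produces such elements, namely
  \<open>b * (x * a - 1) = d * (1 - x * a)\<close> and then \<open>(1 - b * x) * b = (b * x) * d\<close>.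
\<close>

lemma inner_inverse_summandI:
  fixes a b d x :: "'a::{ring, monoid_mult}"
  assumes a: "a = d + b" and x: "a * x * a = a"
    and R: "right_principal b \<inter> right_principal d = {0}"
    and L: "left_principal b \<inter> left_principal d = {0}"
  shows "b * x * b = b"
proof -
  have "b * (x * a - 1) = d * (1 - x * a)"
  proof -
    have "d * (x * a) + b * (x * a) = d + b"
      using x a by (metis distrib_right mult.assoc)
    then show ?thesis by (simp add: right_diff_distrib algebra_simps)
  qed
  then have "b * (x * a - 1) \<in> right_principal b \<inter> right_principal d"
    unfolding right_principal_def by blast
  then have bxa: "b * x * a = b"
    using R by (simp add: right_diff_distrib mult.assoc)
  have "(1 - b * x) * b = b * x * d"
    using bxa a by (simp add: algebra_simps)
  then have "(1 - b * x) * b \<in> left_principal b \<inter> left_principal d"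
    unfolding left_principal_def by blast
  then show ?thesis
    using L by (simp add: left_diff_distrib)
qed

theorem proposition6:
  fixes a b d :: "'a::semiprime_ring"
  assumes "a \<in> Reg" and "b \<in> Reg" and "a = d + b"
  shows "inner_inverses a \<subseteq> inner_inverses b \<longleftrightarrow>
    right_principal b \<inter> right_principal d = {0} \<and> left_principal b \<inter> left_principal d = {0}"
proof
  assume sub: "inner_inverses a \<subseteq> inner_inverses b"
  obtain x where x: "a * x * a = a"
    using assms(1) by (auto simp: Reg_def inner_inverses_def)
  note absorb = inner_inverses_subset_absorb[OF sub x]
  show "right_principal b \<inter> right_principal d = {0} \<and> left_principal b \<inter> left_principal d = {0}"
    using right_principal_inter_trivialI[OF assms(3) absorb(1,2)]
      left_principal_inter_trivialI[OF assms(3) absorb(1,3)] by blast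
next
  assume "right_principal b \<inter> right_principal d = {0} \<and> left_principal b \<inter> left_principal d = {0}"
  then show "inner_inverses a \<subseteq> inner_inverses b"
    using inner_inverse_summandI[OF assms(3)] by (auto simp: inner_inverses_def)
qed

end
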